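(* Let $\mathbf{B}$ be an arbitrary category and let $\mathbf{C}=\mathsf{Cat}(\mathbf{B})$ be the category of internal categories and internal functors in $\mathbf{B}$, equipped with the 2-cell structure given by internal transformations. Then every internal natural transformation is a natural 2-cell; that is, if $\mathbf{t}=(t,h_1,k_1)\in H(A,B)$ is an internal transformation between internal functors $A\to B$ which is an internal natural transformation, then for every internal category $X$ in $\mathbf{B}$ and every $\mathbf{z}\in H(X,A)$, $$\mathrm{cod}(\mathbf{t})\mathbf{z}+\mathbf{t}\,\mathrm{dom}(\mathbf{z})=\mathbf{t}\,\mathrm{cod}(\mathbf{z})+\mathrm{dom}(\mathbf{t})\mathbf{z}.$$
   Context: No existence of pullbacks in $\mathbf{B}$ is assumed. An internal category $A$ in $\mathbf{B}$ is a diagram $(A_0,A_1,A_2,d,c,e,m,\pi_1,\pi_2)$ with $d,c\colon A_1\to A_0$, $e\colon A_0\to A_1$, $m,\pi_1,\pi_2\colon A_2\to A_1$ such that: $de=1_{A_0}=ce$; $dm=d\pi_2$ and $cm=c\pi_1$; the square $d\pi_1=c\pi_2$ is a pullback (so for $u,v\colon Z\to A_1$ with $du=cv$ there is a unique $\langle u,v\rangle\colon Z\to A_2$ with $\pi_1\langle u,v\rangle=u$, $\pi_2\langle u,v\rangle=v$); $m\langle ec,1_{A_1}\rangle=1_{A_1}=m\langle 1_{A_1},ed\rangle$; there is a pullback $A_3$ of $\pi_2\colon A_2\to A_1$ along $\pi_1\colon A_2\to A_1$; and $m(1_{A_1}\times_{A_0}m)=m(m\times_{A_0}1_{A_1})\colon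 A_3\to A_1$. An internal functor $f\colon A\to B$, with $B=(B_0,B_1,B_2,d',c',e',m',\pi_1',\pi_2')$, is a pair $f=(f_0,f_1)$ of morphisms $f_i\colon A_i\to B_i$ with $d'f_1=f_0d$, $c'f_1=f_0c$, $f_1e=e'f_0$ and $f_1m=m'f_2$, where $f_2=\langle f_1\pi_1,f_1\pi_2\rangle\colon A_2\to B_2$. The 2-cell structure of internal transformations on $\mathsf{Cat}(\mathbf{B})$: $H(A,B)$ is the set of triples $\mathbf{t}=(t,h_1,k_1)$ with $t\colon A_0\to B_1$ and $h_1,k_1\colon A_1\to B_1$ such that $h=(h_0,h_1)$ and $k=(k_0,k_1)$, with $h_0=d't$ and $k_0=c't$, are internal functors $A\to B$. One sets $\mathrm{dom}(\mathbf{t})=h$ and $\mathrm{cod}(\mathbf{t})=k$. (No naturality is required of $t$.) For an internal functor $h\colon A\to B$, $0_h=(e'h_0,h_1,h_1)$. If $\mathbf{t}=(t,h_1,k_1)$ and $\mathbf{s}=(s,l_1,h_1)$ in $H(A,B)$ satisfy $\mathrm{dom}(\mathbf{t})=\mathrm{cod}(\mathbf{s})$, then $\mathbf{t}+\mathbf{s}=(m'\langle t,s\rangle,l_1,k_1)$. For internal functors $f\colon A'\to A$ and $g\colon B\to B'$ and $\mathbf{t}=(t,h_1,k_1)\in H(A,B)$, the actions are given by $g\mathbf{t}f=(g_1tf_0,\,g_1h_1f_1,\,g_1k_1f_1)\in H(A',B')$ (with $g\mathbf{t}$ and $\mathbf{t}f$ the cases $f=1_A$, $g=1_B$). An internal transformation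 $\mathbf{t}=(t,h_1,k_1)\in H(A,B)$ is an internal natural transformation if $m'\langle tc,h_1\rangle=m'\langle k_1,td\rangle\colon A_1\to B_1$. *)

theory Defs
  imports Main
begin

record ('o, 'm) cat =
  Ob :: "'o set"
  Ar :: "'m set"
  source :: "'m \<Rightarrow> 'o"
  target :: "'m \<Rightarrow> 'o"
  idn :: "'o \<Rightarrow> 'm"
  cmp :: "'m \<Rightarrow> 'm \<Rightarrow> 'm" (infixl "\<cdot>\<index>" 70)

definition hom :: "('o, 'm) cat \<Rightarrow> 'o \<Rightarrow> 'o \<Rightarrow> 'm set" where
  "hom \<B> a b = {f \<in> Ar \<B>. source \<B> f = a \<and> target \<B> f = b}"

text \<open>Composition is written in applicative order: \<open>g \<cdot> f\<close> is first \<open>f\<close>, then \<open>g\<close>.\<close>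

locale category =
  fixes \<B> :: "('o, 'm) cat" (structure)
  assumes source_Ob: "f \<in> Ar \<B> \<Longrightarrow> source \<B> f \<in> Ob \<B>"
    and target_Ob: "f \<in> Ar \<B> \<Longrightarrow> target \<B> f \<in> Ob \<B>"
    and idn_hom: "a \<in> Ob \<B> \<Longrightarrow> idn \<B> a \<in> hom \<B> a a"
    and cmp_hom: "\<lbrakk>f \<in> hom \<B> a b; g \<in> hom \<B> b c\<rbrakk> \<Longrightarrow> g \<cdot> f \<in> hom \<B> a c"
    and cmp_idn: "f \<in> hom \<B> a b \<Longrightarrow> f \<cdot> idn \<B> a = f"
    and idn_cmp: "f \<in> hom \<B> a b \<Longrightarrow> idn \<B> b \<cdot> f = f"
    and cmp_assoc: "\<lbrakk>f \<in> hom \<B> a b; g \<in> hom \<B> b c; h \<in> hom \<B> c d\<rbrakk>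
      \<Longrightarrow> h \<cdot> (g \<cdot> f) = h \<cdot> g \<cdot> f"

text \<open>The data \<open>(A\<^sub>0, A\<^sub>1, A\<^sub>2, d, c, e, m, \<pi>\<^sub>1, \<pi>\<^sub>2)\<close> of an internal category.\<close>

record ('o, 'm) icat =
  ob0 :: 'o
  ob1 :: 'o
  ob2 :: 'o
  dmap :: 'm
  cmap :: 'm
  emap :: 'm
  mmap :: 'm
  proj1 :: 'm
  proj2 :: 'm

type_synonym 'm ifun = "'m \<times> 'm"
type_synonym 'm itrans = "'m \<times> 'm \<times> 'm"

context category
begin

definition is_pullback :: "'o \<Rightarrow> 'm \<Rightarrow> 'm \<Rightarrow> 'm \<Rightarrow> 'm \<Rightarrow> bool" where
  "is_pullback P p q f g \<longleftrightarrow>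
     f \<in> Ar \<B> \<and> g \<in> Ar \<B> \<and> target \<B> f = target \<B> g \<and>
     p \<in> hom \<B> P (source \<B> f) \<and> q \<in> hom \<B> P (source \<B> g) \<and>
     f \<cdot> p = g \<cdot> q \<and>
     (\<forall>Z. \<forall>u \<in> hom \<B> Z (source \<B> f). \<forall>v \<in> hom \<B> Z (source \<B> g).
        f \<cdot> u = g \<cdot> v \<longrightarrow> (\<exists>!w. w \<in> hom \<B> Z P \<and> p \<cdot> w = u \<and> q \<cdot> w = v))"

text \<open>The morphism \<open>\<langle>u, v\<rangle>\<close> into \<open>A\<^sub>2\<close>; meaningful only when \<open>u\<close> and \<open>v\<close> have a common source
  and \<open>d u = c v\<close>.\<close>

definition pairing :: "('o, 'm) icat \<Rightarrow> 'm \<Rightarrow> 'm \<Rightarrow> 'm" where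
  "pairing A u v =
     (THE w. w \<in> hom \<B> (source \<B> u) (ob2 A) \<and> proj1 A \<cdot> w = u \<and> proj2 A \<cdot> w = v)"

text \<open>In the last clause, \<open>p\<close> and \<open>q\<close> are the projections \<open>A\<^sub>3 \<rightarrow> A\<^sub>2\<close>, and the two pairings are
  \<open>1 \<times> m\<close> and \<open>m \<times> 1\<close>.\<close>

definition internal_category :: "('o, 'm) icat \<Rightarrow> bool" where
  "internal_category A \<longleftrightarrow>
     ob0 A \<in> Ob \<B> \<and> ob1 A \<in> Ob \<B> \<and> ob2 A \<in> Ob \<B> \<and>
     dmap A \<in> hom \<B> (ob1 A) (ob0 A) \<and>
     cmap A \<in> hom \<B> (ob1 A) (ob0 A) \<and>
     emap A \<in> hom \<B> (ob0 A) (ob1 A) \<and>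
     mmap A \<in> hom \<B> (ob2 A) (ob1 A) \<and>
     proj1 A \<in> hom \<B> (ob2 A) (ob1 A) \<and>
     proj2 A \<in> hom \<B> (ob2 A) (ob1 A) \<and>
     dmap A \<cdot> emap A = idn \<B> (ob0 A) \<and>
     cmap A \<cdot> emap A = idn \<B> (ob0 A) \<and>
     dmap A \<cdot> mmap A = dmap A \<cdot> proj2 A \<and>
     cmap A \<cdot> mmap A = cmap A \<cdot> proj1 A \<and>
     is_pullback (ob2 A) (proj1 A) (proj2 A) (dmap A) (cmap A) \<and>
     mmap A \<cdot> pairing A (emap A \<cdot> cmap A) (idn \<B> (ob1 A)) = idn \<B> (ob1 A) \<and>
     mmap A \<cdot> pairing A (idn \<B> (ob1 A)) (emap A \<cdot> dmap A) = idn \<B> (ob1 A) \<and>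
     (\<exists>A\<^sub>3 p q. is_pullback A\<^sub>3 p q (proj2 A) (proj1 A) \<and>
        mmap A \<cdot> pairing A (proj1 A \<cdot> p) (mmap A \<cdot> q) =
        mmap A \<cdot> pairing A (mmap A \<cdot> p) (proj2 A \<cdot> q))"

definition internal_functor :: "('o, 'm) icat \<Rightarrow> ('o, 'm) icat \<Rightarrow> 'm ifun \<Rightarrow> bool" where
  "internal_functor A B = (\<lambda>(f\<^sub>0, f\<^sub>1).
     f\<^sub>0 \<in> hom \<B> (ob0 A) (ob0 B) \<and>
     f\<^sub>1 \<in> hom \<B> (ob1 A) (ob1 B) \<and>
     dmap B \<cdot> f\<^sub>1 = f\<^sub>0 \<cdot> dmap A \<and>
     cmap B \<cdot> f\<^sub>1 = f\<^sub>0 \<cdot> cmap A \<and>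
     f\<^sub>1 \<cdot> emap A = emap B \<cdot> f\<^sub>0 \<and>
     f\<^sub>1 \<cdot> mmap A = mmap B \<cdot> pairing B (f\<^sub>1 \<cdot> proj1 A) (f\<^sub>1 \<cdot> proj2 A))"

definition id_functor :: "('o, 'm) icat \<Rightarrow> 'm ifun" where
  "id_functor A = (idn \<B> (ob0 A), idn \<B> (ob1 A))"

definition comp_functor :: "'m ifun \<Rightarrow> 'm ifun \<Rightarrow> 'm ifun" where
  "comp_functor = (\<lambda>(g\<^sub>0, g\<^sub>1) (f\<^sub>0, f\<^sub>1). (g\<^sub>0 \<cdot> f\<^sub>0, g\<^sub>1 \<cdot> f\<^sub>1))"

text \<open>Domain and codomain of a 2-cell depend on the internal category \<open>B\<close> it takes values in, since
  \<open>h\<^sub>0 = d' t\<close> and \<open>k\<^sub>0 = c' t\<close> are not part of the triple.\<close>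

definition trans_dom :: "('o, 'm) icat \<Rightarrow> 'm itrans \<Rightarrow> 'm ifun" where
  "trans_dom B = (\<lambda>(t, h\<^sub>1, k\<^sub>1). (dmap B \<cdot> t, h\<^sub>1))"

definition trans_cod :: "('o, 'm) icat \<Rightarrow> 'm itrans \<Rightarrow> 'm ifun" where
  "trans_cod B = (\<lambda>(t, h\<^sub>1, k\<^sub>1). (cmap B \<cdot> t, k\<^sub>1))"

definition H :: "('o, 'm) icat \<Rightarrow> ('o, 'm) icat \<Rightarrow> 'm itrans set" where
  "H A B = {(t, h\<^sub>1, k\<^sub>1).
     t \<in> hom \<B> (ob0 A) (ob1 B) \<and>
     h\<^sub>1 \<in> hom \<B> (ob1 A) (ob1 B) \<and>
     k\<^sub>1 \<in> hom \<B> (ob1 A) (ob1 B) \<and>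
     internal_functor A B (trans_dom B (t, h\<^sub>1, k\<^sub>1)) \<and>
     internal_functor A B (trans_cod B (t, h\<^sub>1, k\<^sub>1))}"

definition trans_zero :: "('o, 'm) icat \<Rightarrow> 'm ifun \<Rightarrow> 'm itrans" where
  "trans_zero B = (\<lambda>(h\<^sub>0, h\<^sub>1). (emap B \<cdot> h\<^sub>0, h\<^sub>1, h\<^sub>1))"

text \<open>\<open>trans_add B t s\<close> is \<open>t + s\<close> (first \<open>s\<close>, then \<open>t\<close>); meaningful only when
  \<open>trans_dom B t = trans_cod B s\<close>.\<close>

definition trans_add :: "('o, 'm) icat \<Rightarrow> 'm itrans \<Rightarrow> 'm itrans \<Rightarrow> 'm itrans" where
  "trans_add B = (\<lambda>(t, h\<^sub>1, k\<^sub>1) (s, l\<^sub>1, h\<^sub>1'). (mmap B \<cdot> pairing B t s, l\<^sub>1, k\<^sub>1))"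

definition trans_act :: "'m ifun \<Rightarrow> 'm itrans \<Rightarrow> 'm ifun \<Rightarrow> 'm itrans" where
  "trans_act = (\<lambda>(g\<^sub>0, g\<^sub>1) (t, h\<^sub>1, k\<^sub>1) (f\<^sub>0, f\<^sub>1).
     (g\<^sub>1 \<cdot> t \<cdot> f\<^sub>0, g\<^sub>1 \<cdot> h\<^sub>1 \<cdot> f\<^sub>1, g\<^sub>1 \<cdot> k\<^sub>1 \<cdot> f\<^sub>1))"

text \<open>The one-sided actions \<open>g t\<close>, for \<open>t \<in> H(A, B)\<close> (needing \<open>1\<^sub>A\<close>), and \<open>t f\<close> (needing \<open>1\<^sub>B\<close>).\<close>

definition left_act :: "('o, 'm) icat \<Rightarrow> 'm ifun \<Rightarrow> 'm itrans \<Rightarrow> 'm itrans" where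
  "left_act A g t = trans_act g t (id_functor A)"

definition right_act :: "('o, 'm) icat \<Rightarrow> 'm itrans \<Rightarrow> 'm ifun \<Rightarrow> 'm itrans" where
  "right_act B t f = trans_act (id_functor B) t f"

definition internal_natural ::
    "('o, 'm) icat \<Rightarrow> ('o, 'm) icat \<Rightarrow> 'm itrans \<Rightarrow> bool" where
  "internal_natural A B = (\<lambda>(t, h\<^sub>1, k\<^sub>1).
     mmap B \<cdot> pairing B (t \<cdot> cmap A) h\<^sub>1 = mmap B \<cdot> pairing B k\<^sub>1 (t \<cdot> dmap A))"

text \<open>All sums here are of composable 2-cells; see \<open>natural_2cell_lhs_composable\<close> and
  \<open>natural_2cell_rhs_composable\<close> below.\<close>

definition natural_2cell ::
    "('o, 'm) icat \<Rightarrow> ('o, 'm) icat \<Rightarrow> 'm itrans \<Rightarrow> bool" where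
  "natural_2cell A B t \<longleftrightarrow>
     (\<forall>X z. internal_category X \<longrightarrow> z \<in> H X A \<longrightarrow>
        trans_add B (left_act X (trans_cod B t) z) (right_act B t (trans_dom A z)) =
        trans_add B (right_act B t (trans_cod A z)) (left_act X (trans_dom B t) z))"

lemma homD: "f \<in> hom \<B> a b \<Longrightarrow> f \<in> Ar \<B> \<and> source \<B> f = a \<and> target \<B> f = b \<and> a \<in> Ob \<B> \<and> b \<in> Ob \<B>"
  using source_Ob target_Ob by (auto simp: hom_def)

lemma
  assumes A: "internal_category A"
    and u: "u \<in> hom \<B> Z (ob1 A)" and v: "v \<in> hom \<B> Z (ob1 A)"
    and uv: "dmap A \<cdot> u = cmap A \<cdot> v"
  shows pairing_hom: "pairing A u v \<in> hom \<B> Z (ob2 A)"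
    and proj1_pairing: "proj1 A \<cdot> pairing A u v = u"
    and proj2_pairing: "proj2 A \<cdot> pairing A u v = v"
    and pairing_eqI: "\<And>w. \<lbrakk>w \<in> hom \<B> Z (ob2 A); proj1 A \<cdot> w = u; proj2 A \<cdot> w = v\<rbrakk>
      \<Longrightarrow> pairing A u v = w"
proof -
  have s: "source \<B> u = Z" "source \<B> (dmap A) = ob1 A" "source \<B> (cmap A) = ob1 A"
    using u A homD by (auto simp: internal_category_def)
  have ex: "\<exists>!w. w \<in> hom \<B> Z (ob2 A) \<and> proj1 A \<cdot> w = u \<and> proj2 A \<cdot> w = v"
    using A u v uv s unfolding internal_category_def is_pullback_def by metis
  from theI'[OF ex]
  show "pairing A u v \<in> hom \<B> Z (ob2 A)" "proj1 A \<cdot> pairing A u v = u"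
    "proj2 A \<cdot> pairing A u v = v"
    by (simp_all add: pairing_def s)
  show "\<And>w. \<lbrakk>w \<in> hom \<B> Z (ob2 A); proj1 A \<cdot> w = u; proj2 A \<cdot> w = v\<rbrakk> \<Longrightarrow> pairing A u v = w"
    using the1_equality[OF ex] by (simp add: pairing_def s)
qed

lemma pairing_cmp:
  assumes A: "internal_category A"
    and u: "u \<in> hom \<B> Z (ob1 A)" and v: "v \<in> hom \<B> Z (ob1 A)"
    and uv: "dmap A \<cdot> u = cmap A \<cdot> v" and x: "x \<in> hom \<B> Y Z"
  shows "pairing A u v \<cdot> x = pairing A (u \<cdot> x) (v \<cdot> x)"
proof (rule sym, rule pairing_eqI[OF A])
  have h: "dmap A \<in> hom \<B> (ob1 A) (ob0 A)" "cmap A \<in> hom \<B> (ob1 A) (ob0 A)"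
    "proj1 A \<in> hom \<B> (ob2 A) (ob1 A)" "proj2 A \<in> hom \<B> (ob2 A) (ob1 A)"
    using A by (auto simp: internal_category_def)
  note p = pairing_hom[OF A u v uv]
  show "u \<cdot> x \<in> hom \<B> Y (ob1 A)" "v \<cdot> x \<in> hom \<B> Y (ob1 A)"
    using u v x cmp_hom by auto
  show "dmap A \<cdot> (u \<cdot> x) = cmap A \<cdot> (v \<cdot> x)"
    using cmp_assoc[OF x u h(1)] cmp_assoc[OF x v h(2)] uv by simp
  show "pairing A u v \<cdot> x \<in> hom \<B> Y (ob2 A)" using cmp_hom[OF x p] .
  show "proj1 A \<cdot> (pairing A u v \<cdot> x) = u \<cdot> x"
    using cmp_assoc[OF x p h(3)] proj1_pairing[OF A u v uv] by simp
  show "proj2 A \<cdot> (pairing A u v \<cdot> x) = v \<cdot> x"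
    using cmp_assoc[OF x p h(4)] proj2_pairing[OF A u v uv] by simp
qed

lemma functor_pairing:
  assumes A: "internal_category A" and B: "internal_category B"
    and f: "internal_functor A B (f\<^sub>0, f\<^sub>1)"
    and u: "u \<in> hom \<B> Z (ob1 A)" and v: "v \<in> hom \<B> Z (ob1 A)"
    and uv: "dmap A \<cdot> u = cmap A \<cdot> v"
  shows "dmap B \<cdot> (f\<^sub>1 \<cdot> u) = cmap B \<cdot> (f\<^sub>1 \<cdot> v)"
    and "f\<^sub>1 \<cdot> (mmap A \<cdot> pairing A u v) = mmap B \<cdot> pairing B (f\<^sub>1 \<cdot> u) (f\<^sub>1 \<cdot> v)"
proof -
  have hA: "dmap A \<in> hom \<B> (ob1 A) (ob0 A)" "cmap A \<in> hom \<B> (ob1 A) (ob0 A)"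
    "proj1 A \<in> hom \<B> (ob2 A) (ob1 A)" "proj2 A \<in> hom \<B> (ob2 A) (ob1 A)"
    "mmap A \<in> hom \<B> (ob2 A) (ob1 A)" "dmap A \<cdot> proj1 A = cmap A \<cdot> proj2 A"
    using A by (auto simp: internal_category_def is_pullback_def)
  have hB: "dmap B \<in> hom \<B> (ob1 B) (ob0 B)" "cmap B \<in> hom \<B> (ob1 B) (ob0 B)"
    "mmap B \<in> hom \<B> (ob2 B) (ob1 B)"
    using B by (auto simp: internal_category_def)
  have hf: "f\<^sub>0 \<in> hom \<B> (ob0 A) (ob0 B)" "f\<^sub>1 \<in> hom \<B> (ob1 A) (ob1 B)"
    "dmap B \<cdot> f\<^sub>1 = f\<^sub>0 \<cdot> dmap A" "cmap B \<cdot> f\<^sub>1 = f\<^sub>0 \<cdot> cmap A"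
    "f\<^sub>1 \<cdot> mmap A = mmap B \<cdot> pairing B (f\<^sub>1 \<cdot> proj1 A) (f\<^sub>1 \<cdot> proj2 A)"
    using f by (auto simp: internal_functor_def)
  have c: "dmap B \<cdot> (f\<^sub>1 \<cdot> u) = cmap B \<cdot> (f\<^sub>1 \<cdot> v)"
    if "u \<in> hom \<B> Z (ob1 A)" "v \<in> hom \<B> Z (ob1 A)" "dmap A \<cdot> u = cmap A \<cdot> v" for u v Z
    using cmp_assoc[OF that(1) hf(2) hB(1)] cmp_assoc[OF that(2) hf(2) hB(2)]
      cmp_assoc[OF that(1) hA(1) hf(1)] cmp_assoc[OF that(2) hA(2) hf(1)] hf(3,4) that(3)
    by simp
  show "dmap B \<cdot> (f\<^sub>1 \<cdot> u) = cmap B \<cdot> (f\<^sub>1 \<cdot> v)" by (rule c[OF u v uv])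
  note p = pairing_hom[OF A u v uv]
  note q = cmp_hom[OF hA(3) hf(2)] cmp_hom[OF hA(4) hf(2)] c[OF hA(3,4,6)]
  have "f\<^sub>1 \<cdot> (mmap A \<cdot> pairing A u v)
      = mmap B \<cdot> pairing B (f\<^sub>1 \<cdot> proj1 A) (f\<^sub>1 \<cdot> proj2 A) \<cdot> pairing A u v"
    using cmp_assoc[OF p hA(5) hf(2)] hf(5) by simp
  also have "\<dots> = mmap B \<cdot> (pairing B (f\<^sub>1 \<cdot> proj1 A) (f\<^sub>1 \<cdot> proj2 A) \<cdot> pairing A u v)"
    using cmp_assoc[OF p pairing_hom[OF B q] hB(3)] by simp
  also have "\<dots> = mmap B \<cdot> pairing B (f\<^sub>1 \<cdot> u) (f\<^sub>1 \<cdot> v)"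
    using pairing_cmp[OF B q p] cmp_assoc[OF p hA(3) hf(2)] cmp_assoc[OF p hA(4) hf(2)]
      proj1_pairing[OF A u v uv] proj2_pairing[OF A u v uv] by simp
  finally show "f\<^sub>1 \<cdot> (mmap A \<cdot> pairing A u v) = mmap B \<cdot> pairing B (f\<^sub>1 \<cdot> u) (f\<^sub>1 \<cdot> v)" .
qed

lemma internal_functor_id:
  assumes A: "internal_category A"
  shows "internal_functor A A (id_functor A)"
proof -
  have hA: "dmap A \<in> hom \<B> (ob1 A) (ob0 A)" "cmap A \<in> hom \<B> (ob1 A) (ob0 A)"
    "emap A \<in> hom \<B> (ob0 A) (ob1 A)" "mmap A \<in> hom \<B> (ob2 A) (ob1 A)"
    "proj1 A \<in> hom \<B> (ob2 A) (ob1 A)" "proj2 A \<in> hom \<B> (ob2 A) (ob1 A)"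
    "dmap A \<cdot> proj1 A = cmap A \<cdot> proj2 A" "ob0 A \<in> Ob \<B>" "ob1 A \<in> Ob \<B>" "ob2 A \<in> Ob \<B>"
    using A by (auto simp: internal_category_def is_pullback_def)
  have "pairing A (proj1 A) (proj2 A) = idn \<B> (ob2 A)"
    using pairing_eqI[OF A hA(5-7) idn_hom[OF hA(10)]] hA(5,6) cmp_idn by simp
  then show ?thesis
    using hA idn_hom cmp_idn idn_cmp by (auto simp: internal_functor_def id_functor_def)
qed

lemma internal_functor_comp:
  assumes A: "internal_category A" and B: "internal_category B" and C: "internal_category C"
    and f: "internal_functor A B f" and g: "internal_functor B C g"
  shows "internal_functor A C (comp_functor g f)"
proof -
  obtain f0 f1 g0 g1 where fg: "f = (f0, f1)" "g = (g0, g1)" by fastforce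
  have hA: "dmap A \<in> hom \<B> (ob1 A) (ob0 A)" "cmap A \<in> hom \<B> (ob1 A) (ob0 A)"
    "emap A \<in> hom \<B> (ob0 A) (ob1 A)" "mmap A \<in> hom \<B> (ob2 A) (ob1 A)"
    "proj1 A \<in> hom \<B> (ob2 A) (ob1 A)" "proj2 A \<in> hom \<B> (ob2 A) (ob1 A)"
    "dmap A \<cdot> proj1 A = cmap A \<cdot> proj2 A"
    using A by (auto simp: internal_category_def is_pullback_def)
  have hB: "dmap B \<in> hom \<B> (ob1 B) (ob0 B)" "cmap B \<in> hom \<B> (ob1 B) (ob0 B)"
    "emap B \<in> hom \<B> (ob0 B) (ob1 B)"
    using B by (auto simp: internal_category_def)
  have hC: "dmap C \<in> hom \<B> (ob1 C) (ob0 C)" "cmap C \<in> hom \<B> (ob1 C) (ob0 C)"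
    "emap C \<in> hom \<B> (ob0 C) (ob1 C)"
    using C by (auto simp: internal_category_def)
  have hf: "f0 \<in> hom \<B> (ob0 A) (ob0 B)" "f1 \<in> hom \<B> (ob1 A) (ob1 B)"
    "dmap B \<cdot> f1 = f0 \<cdot> dmap A" "cmap B \<cdot> f1 = f0 \<cdot> cmap A" "f1 \<cdot> emap A = emap B \<cdot> f0"
    "f1 \<cdot> mmap A = mmap B \<cdot> pairing B (f1 \<cdot> proj1 A) (f1 \<cdot> proj2 A)"
    using f by (auto simp: internal_functor_def fg)
  have hg: "g0 \<in> hom \<B> (ob0 B) (ob0 C)" "g1 \<in> hom \<B> (ob1 B) (ob1 C)"
    "dmap C \<cdot> g1 = g0 \<cdot> dmap B" "cmap C \<cdot> g1 = g0 \<cdot> cmap B" "g1 \<cdot> emap B = emap C \<cdot> g0"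
    using g by (auto simp: internal_functor_def fg)
  have eq: "x \<cdot> (g' \<cdot> f') = g'' \<cdot> f'' \<cdot> y"
    if "x \<cdot> g' = g'' \<cdot> z" "z \<cdot> f' = f'' \<cdot> y" "x \<in> hom \<B> c d" "g' \<in> hom \<B> b c" "f' \<in> hom \<B> a b"
      "g'' \<in> hom \<B> b' d" "z \<in> hom \<B> b b'" "f'' \<in> hom \<B> a' b'" "y \<in> hom \<B> a a'"
    for x y z f' g' f'' g'' a b c d a' b'
    using cmp_assoc[OF that(5,4,3)] cmp_assoc[OF that(5,7,6)] cmp_assoc[OF that(9,8,6)] that(1,2)
    by simp
  have e: "g1 \<cdot> f1 \<cdot> emap A = emap C \<cdot> (g0 \<cdot> f0)"
    using cmp_assoc[OF hA(3) hf(2) hg(2)] cmp_assoc[OF hf(1) hB(3) hg(2)]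
      cmp_assoc[OF hf(1) hg(1) hC(3)] hf(5) hg(5) by simp
  have "g1 \<cdot> f1 \<cdot> mmap A = g1 \<cdot> (mmap B \<cdot> pairing B (f1 \<cdot> proj1 A) (f1 \<cdot> proj2 A))"
    using cmp_assoc[OF hA(4) hf(2) hg(2)] hf(6) by simp
  also have "\<dots> = mmap C \<cdot> pairing C (g1 \<cdot> (f1 \<cdot> proj1 A)) (g1 \<cdot> (f1 \<cdot> proj2 A))"
    by (rule functor_pairing(2)[OF B C g[unfolded fg] cmp_hom[OF hA(5) hf(2)]
          cmp_hom[OF hA(6) hf(2)] functor_pairing(1)[OF A B f[unfolded fg] hA(5-7)]])
  also have "\<dots> = mmap C \<cdot> pairing C (g1 \<cdot> f1 \<cdot> proj1 A) (g1 \<cdot> f1 \<cdot> proj2 A)"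
    using cmp_assoc[OF hA(5) hf(2) hg(2)] cmp_assoc[OF hA(6) hf(2) hg(2)] by simp
  finally show ?thesis
    using eq[OF hg(3) hf(3) hC(1) hg(2) hf(2) hg(1) hB(1) hf(1) hA(1)]
      eq[OF hg(4) hf(4) hC(2) hg(2) hf(2) hg(1) hB(2) hf(1) hA(2)] e
      cmp_hom[OF hf(1) hg(1)] cmp_hom[OF hf(2) hg(2)]
    by (simp add: internal_functor_def comp_functor_def fg)
qed

text \<open>The category of internal categories; a morphism carries its source and target.\<close>

definition Cat :: "(('o, 'm) icat, ('o, 'm) icat \<times> ('o, 'm) icat \<times> 'm ifun) cat" where
  "Cat = \<lparr>Ob = {A. internal_category A},
     Ar = {(A, B, f). internal_category A \<and> internal_category B \<and> internal_functor A B f},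
     source = (\<lambda>(A, B, f). A),
     target = (\<lambda>(A, B, f). B),
     idn = (\<lambda>A. (A, A, id_functor A)),
     cmp = (\<lambda>(B', C, g) (A, B, f). (A, C, comp_functor g f))\<rparr>"

lemma category_Cat: "category Cat"
proof -
  have 1: "comp_functor f (id_functor A) = f \<and> comp_functor (id_functor B) f = f"
    if "internal_functor A B f" for A B f
    using that cmp_idn idn_cmp
    by (cases f) (auto simp: internal_functor_def comp_functor_def id_functor_def)
  have 2: "comp_functor h (comp_functor g f) = comp_functor (comp_functor h g) f"
    if "internal_functor A B f" "internal_functor B C g" "internal_functor C D h" for A B C D f g h
    using that cmp_assoc
    by (cases f; cases g; cases h) (auto simp: internal_functor_def comp_functor_def)
  show ?thesis
    by standard
      (auto simp: Cat_def hom_def internal_functor_id internal_functor_comp 1 2)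
qed

lemma trans_zero_H:
  assumes A: "internal_category A" and B: "internal_category B" and h: "internal_functor A B h"
  shows "trans_zero B h \<in> H A B" "trans_dom B (trans_zero B h) = h" "trans_cod B (trans_zero B h) = h"
proof -
  obtain h0 h1 where hh: "h = (h0, h1)" by fastforce
  have hB: "dmap B \<in> hom \<B> (ob1 B) (ob0 B)" "cmap B \<in> hom \<B> (ob1 B) (ob0 B)"
    "emap B \<in> hom \<B> (ob0 B) (ob1 B)" "dmap B \<cdot> emap B = idn \<B> (ob0 B)"
    "cmap B \<cdot> emap B = idn \<B> (ob0 B)"
    using B by (auto simp: internal_category_def)
  have h01: "h0 \<in> hom \<B> (ob0 A) (ob0 B)" "h1 \<in> hom \<B> (ob1 A) (ob1 B)"
    using h by (auto simp: internal_functor_def hh)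
  show *: "trans_dom B (trans_zero B h) = h" "trans_cod B (trans_zero B h) = h"
    using cmp_assoc[OF h01(1) hB(3) hB(1)] cmp_assoc[OF h01(1) hB(3) hB(2)] hB(4,5)
      idn_cmp[OF h01(1)]
    by (simp_all add: hh trans_zero_def trans_dom_def trans_cod_def)
  then show "trans_zero B h \<in> H A B"
    using h h01 cmp_hom[OF h01(1) hB(3)] by (simp add: hh H_def trans_zero_def)
qed

lemma trans_add_H:
  assumes A: "internal_category A" and B: "internal_category B"
    and t: "t \<in> H A B" and s: "s \<in> H A B" and ts: "trans_dom B t = trans_cod B s"
  shows "trans_add B t s \<in> H A B"
    "trans_dom B (trans_add B t s) = trans_dom B s" "trans_cod B (trans_add B t s) = trans_cod B t"
proof -
  obtain t' h1 k1 s' l1 h1' where e: "t = (t', h1, k1)" "s = (s', l1, h1')"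
    by (metis prod.exhaust)
  have hB: "dmap B \<in> hom \<B> (ob1 B) (ob0 B)" "cmap B \<in> hom \<B> (ob1 B) (ob0 B)"
    "mmap B \<in> hom \<B> (ob2 B) (ob1 B)"
    "proj1 B \<in> hom \<B> (ob2 B) (ob1 B)" "proj2 B \<in> hom \<B> (ob2 B) (ob1 B)"
    "dmap B \<cdot> mmap B = dmap B \<cdot> proj2 B" "cmap B \<cdot> mmap B = cmap B \<cdot> proj1 B"
    using B by (auto simp: internal_category_def)
  have q: "t' \<in> hom \<B> (ob0 A) (ob1 B)" "s' \<in> hom \<B> (ob0 A) (ob1 B)" "dmap B \<cdot> t' = cmap B \<cdot> s'"
    using t s ts by (auto simp: e H_def trans_dom_def trans_cod_def)
  note p = pairing_hom[OF B q]
  show *: "trans_dom B (trans_add B t s) = trans_dom B s"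
    "trans_cod B (trans_add B t s) = trans_cod B t"
    using cmp_assoc[OF p hB(3) hB(1)] cmp_assoc[OF p hB(3) hB(2)] cmp_assoc[OF p hB(5) hB(1)]
      cmp_assoc[OF p hB(4) hB(2)] hB(6,7) proj1_pairing[OF B q] proj2_pairing[OF B q]
    by (simp_all add: e trans_add_def trans_dom_def trans_cod_def)
  then show "trans_add B t s \<in> H A B"
    using t s cmp_hom[OF p hB(3)] by (simp add: e H_def trans_add_def)
qed

lemma trans_act_H:
  assumes A': "internal_category A'" and A: "internal_category A"
    and B: "internal_category B" and B': "internal_category B'"
    and f: "internal_functor A' A f" and t: "t \<in> H A B" and g: "internal_functor B B' g"
  shows "trans_act g t f \<in> H A' B'"
    "trans_dom B' (trans_act g t f) = comp_functor (comp_functor g (trans_dom B t)) f"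
    "trans_cod B' (trans_act g t f) = comp_functor (comp_functor g (trans_cod B t)) f"
proof -
  obtain f0 f1 g0 g1 t' h1 k1 where e: "f = (f0, f1)" "g = (g0, g1)" "t = (t', h1, k1)"
    by (metis prod.exhaust)
  have hB: "dmap B \<in> hom \<B> (ob1 B) (ob0 B)" "cmap B \<in> hom \<B> (ob1 B) (ob0 B)"
    "dmap B' \<in> hom \<B> (ob1 B') (ob0 B')" "cmap B' \<in> hom \<B> (ob1 B') (ob0 B')"
    using B B' by (auto simp: internal_category_def)
  have hf: "f0 \<in> hom \<B> (ob0 A') (ob0 A)" "f1 \<in> hom \<B> (ob1 A') (ob1 A)"
    using f by (auto simp: internal_functor_def e)
  have hg: "g0 \<in> hom \<B> (ob0 B) (ob0 B')" "g1 \<in> hom \<B> (ob1 B) (ob1 B')"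
    "dmap B' \<cdot> g1 = g0 \<cdot> dmap B" "cmap B' \<cdot> g1 = g0 \<cdot> cmap B"
    using g by (auto simp: internal_functor_def e)
  have ht: "t' \<in> hom \<B> (ob0 A) (ob1 B)" "h1 \<in> hom \<B> (ob1 A) (ob1 B)" "k1 \<in> hom \<B> (ob1 A) (ob1 B)"
    "internal_functor A B (trans_dom B t)" "internal_functor A B (trans_cod B t)"
    using t by (auto simp: H_def e)
  have gt: "g1 \<cdot> t' \<in> hom \<B> (ob0 A) (ob1 B')" using cmp_hom[OF ht(1) hg(2)] .
  show *: "trans_dom B' (trans_act g t f) = comp_functor (comp_functor g (trans_dom B t)) f"
    "trans_cod B' (trans_act g t f) = comp_functor (comp_functor g (trans_cod B t)) f"
    using cmp_assoc[OF hf(1) gt hB(3)] cmp_assoc[OF hf(1) gt hB(4)]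
      cmp_assoc[OF ht(1) hg(2) hB(3)] cmp_assoc[OF ht(1) hg(2) hB(4)]
      cmp_assoc[OF ht(1) hB(1) hg(1)] cmp_assoc[OF ht(1) hB(2) hg(1)] hg(3,4)
    by (simp_all add: e trans_act_def trans_dom_def trans_cod_def comp_functor_def)
  have "internal_functor A' B' (trans_dom B' (trans_act g t f))"
    "internal_functor A' B' (trans_cod B' (trans_act g t f))"
    unfolding * using internal_functor_comp A' A B B' f g ht(4,5) by blast+
  then show "trans_act g t f \<in> H A' B'"
    using cmp_hom[OF hf(1) gt] cmp_hom[OF hf(2) cmp_hom[OF ht(2) hg(2)]]
      cmp_hom[OF hf(2) cmp_hom[OF ht(3) hg(2)]]
    by (simp add: e H_def trans_act_def)
qed

lemma comp_functor_id:
  assumes "internal_functor A B f"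
  shows "comp_functor f (id_functor A) = f" "comp_functor (id_functor B) f = f"
  using assms cmp_idn idn_cmp
  by (cases f; auto simp: internal_functor_def comp_functor_def id_functor_def)+

lemma HD: "t \<in> H A B \<Longrightarrow> internal_functor A B (trans_dom B t) \<and> internal_functor A B (trans_cod B t)"
  by (auto simp: H_def)

lemma
  assumes "internal_category A" "internal_category B" "internal_category B'"
    and "t \<in> H A B" "internal_functor B B' g"
  shows left_act_H: "left_act A g t \<in> H A B'"
    and trans_dom_left_act: "trans_dom B' (left_act A g t) = comp_functor g (trans_dom B t)"
    and trans_cod_left_act: "trans_cod B' (left_act A g t) = comp_functor g (trans_cod B t)"
  unfolding left_act_def
  using trans_act_H[OF assms(1) assms(1-3) internal_functor_id assms(4,5)] HD[OF assms(4)]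
    internal_functor_comp[OF assms(1-3) _ assms(5)] assms(1) comp_functor_id(1)
  by metis+

lemma
  assumes "internal_category A'" "internal_category A" "internal_category B"
    and "t \<in> H A B" "internal_functor A' A f"
  shows right_act_H: "right_act B t f \<in> H A' B"
    and trans_dom_right_act: "trans_dom B (right_act B t f) = comp_functor (trans_dom B t) f"
    and trans_cod_right_act: "trans_cod B (right_act B t f) = comp_functor (trans_cod B t) f"
  unfolding right_act_def
  using trans_act_H[OF assms(1-3) assms(3,5,4) internal_functor_id] HD[OF assms(4)]
    assms(3) comp_functor_id(2)
  by metis+

lemma natural_2cell_lhs_composable:
  assumes "internal_category X" "internal_category A" "internal_category B"
    and "t \<in> H A B" "z \<in> H X A"
  shows "trans_dom B (left_act X (trans_cod B t) z) = trans_cod B (right_act B t (trans_dom A z))"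
  using assms HD trans_dom_left_act trans_cod_right_act by metis

lemma natural_2cell_rhs_composable:
  assumes "internal_category X" "internal_category A" "internal_category B"
    and "t \<in> H A B" "z \<in> H X A"
  shows "trans_dom B (right_act B t (trans_cod A z)) = trans_cod B (left_act X (trans_dom B t) z)"
  using assms HD trans_cod_left_act trans_dom_right_act by metis

end

end

theory Submission
  imports Defs
begin

text \<open>Naturality of \<open>t\<close> is an equation between morphisms \<open>A\<^sub>1 \<rightarrow> B\<^sub>1\<close>. The two sides of the
  2-cell equation for \<open>z = (z, p\<^sub>1, q\<^sub>1)\<close> have the same outer components \<open>h\<^sub>1 p\<^sub>1\<close> and \<open>k\<^sub>1 q\<^sub>1\<close>, and
  their first components are the two sides of the naturality equation composed with
  \<open>z : X\<^sub>0 \<rightarrow> A\<^sub>1\<close>.\<close>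

context category
begin

text \<open>Uniqueness of pairings moves \<open>x\<close> inside the pairing, and associativity
  moves it past \<open>mmap A\<close>. This is how both sides of the naturality equation get
  restricted along \<open>z'\<close>.\<close>

lemma mmap_pairing_cmp:
  assumes A: "internal_category A"
    and u: "u \<in> hom \<B> Z (ob1 A)" and v: "v \<in> hom \<B> Z (ob1 A)"
    and uv: "dmap A \<cdot> u = cmap A \<cdot> v" and x: "x \<in> hom \<B> Y Z"
  shows "mmap A \<cdot> pairing A u v \<cdot> x = mmap A \<cdot> pairing A (u \<cdot> x) (v \<cdot> x)"
proof -
  have "mmap A \<in> hom \<B> (ob2 A) (ob1 A)"
    using A by (simp add: internal_category_def)
  from cmp_assoc[OF x pairing_hom[OF A u v uv] this] show ?thesis
    by (simp add: pairing_cmp[OF A u v uv x])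
qed

lemma internal_natural_imp_natural_2cell:
  assumes A: "internal_category A" and B: "internal_category B"
    and t: "t \<in> H A B" and nat: "internal_natural A B t"
  shows "natural_2cell A B t"
  unfolding natural_2cell_def
proof (intro allI impI)
  fix X z
  assume z: "z \<in> H X A"
  obtain t' h1 k1 z' p1 q1 where e: "t = (t', h1, k1)" "z = (z', p1, q1)"
    by (metis prod.exhaust)
  have hA: "dmap A \<in> hom \<B> (ob1 A) (ob0 A)" "cmap A \<in> hom \<B> (ob1 A) (ob0 A)"
    using A by (auto simp: internal_category_def)
  have hB: "dmap B \<in> hom \<B> (ob1 B) (ob0 B)" "cmap B \<in> hom \<B> (ob1 B) (ob0 B)"
    using B by (auto simp: internal_category_def)
  have ht: "t' \<in> hom \<B> (ob0 A) (ob1 B)" "h1 \<in> hom \<B> (ob1 A) (ob1 B)" "k1 \<in> hom \<B> (ob1 A) (ob1 B)"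
    "cmap B \<cdot> h1 = dmap B \<cdot> t' \<cdot> cmap A" "dmap B \<cdot> k1 = cmap B \<cdot> t' \<cdot> dmap A"
    using t by (auto simp: H_def e internal_functor_def trans_dom_def trans_cod_def)
  have hz: "z' \<in> hom \<B> (ob0 X) (ob1 A)" "p1 \<in> hom \<B> (ob1 X) (ob1 A)" "q1 \<in> hom \<B> (ob1 X) (ob1 A)"
    using z by (auto simp: H_def e)
  note tc = cmp_hom[OF hA(2) ht(1)] and td = cmp_hom[OF hA(1) ht(1)]
  \<comment> \<open>Both pairings in the naturality equation are defined: the functors
    \<open>trans_dom B t\<close> and \<open>trans_cod B t\<close> have object parts
    \<open>dmap B \<cdot> t'\<close> and \<open>cmap B \<cdot> t'\<close>.\<close>
  have c: "dmap B \<cdot> (t' \<cdot> cmap A) = cmap B \<cdot> h1" "dmap B \<cdot> k1 = cmap B \<cdot> (t' \<cdot> dmap A)"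
    using cmp_assoc[OF hA(2) ht(1) hB(1)] cmp_assoc[OF hA(1) ht(1) hB(2)] ht(4,5) by simp_all
  \<comment> \<open>The start of this chain is the first component of the left-hand sum, as
    \<open>trans_dom A z\<close> has object part \<open>dmap A \<cdot> z'\<close>; the end is that
    of the right-hand sum.\<close>
  have "mmap B \<cdot> pairing B (k1 \<cdot> z') (t' \<cdot> (dmap A \<cdot> z'))
      = mmap B \<cdot> pairing B k1 (t' \<cdot> dmap A) \<cdot> z'"
    by (simp add: mmap_pairing_cmp[OF B ht(3) td c(2) hz(1)] cmp_assoc[OF hz(1) hA(1) ht(1)])
  also have "\<dots> = mmap B \<cdot> pairing B (t' \<cdot> cmap A) h1 \<cdot> z'"
    using nat by (simp add: internal_natural_def e)
  also have "\<dots> = mmap B \<cdot> pairing B (t' \<cdot> (cmap A \<cdot> z')) (h1 \<cdot> z')"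
    by (simp add: mmap_pairing_cmp[OF B tc ht(2) c(1) hz(1)] cmp_assoc[OF hz(1) hA(2) ht(1)])
  \<comment> \<open>The identities come from the one-sided actions. Addition discards the inner
    components, so only the outer ones \<open>h1 \<cdot> p1\<close> and \<open>k1 \<cdot> q1\<close>
    remain to be compared.\<close>
  finally show "trans_add B (left_act X (trans_cod B t) z) (right_act B t (trans_dom A z)) =
      trans_add B (right_act B t (trans_cod A z)) (left_act X (trans_dom B t) z)"
    using cmp_idn[OF cmp_hom[OF hz(1) ht(2)]] cmp_idn[OF cmp_hom[OF hz(1) ht(3)]]
      cmp_idn[OF cmp_hom[OF hz(2) ht(2)]] cmp_idn[OF cmp_hom[OF hz(3) ht(3)]]
      idn_cmp[OF ht(1)] idn_cmp[OF ht(2)] idn_cmp[OF ht(3)]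
    by (simp add: e trans_add_def left_act_def right_act_def trans_act_def id_functor_def
        trans_dom_def trans_cod_def)
qed

end

theorem corollary5p7:
  fixes \<B> :: "('o, 'm) cat"
    and A B :: "('o, 'm) icat"
    and t :: "'m itrans"
  assumes "category \<B>"
    and "category.internal_category \<B> A"
    and "category.internal_category \<B> B"
    and "t \<in> category.H \<B> A B"
    and "category.internal_natural \<B> A B t"
  shows "category.natural_2cell \<B> A B t"
  using category.internal_natural_imp_natural_2cell[OF assms] .

end
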